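(* Let $G$ be a group of orientation-preserving homeomorphisms of the circle $S^1$ such that the set $P(G)$ of points of $S^1$ with finite $G$-orbit is finite and nonempty. Suppose that for each connected component $C_\alpha$ of $S^1\setminus P(G)$, the group $G$ restricted to $C_\alpha$ satisfies (C1) or (C2) (as defined in the context). Then for every $x\in S^1\setminus P(G)$, at least one of the following four possibilities holds for the orbit $\mathcal O(x)$: (1) $\mathcal O(x)$ is dense in $\mathcal R(x)$. (2) $\mathcal O(x)$ accumulates only at points of $P(G)$. (3) $\mathcal O(x)$ is contained in a $G$-invariant Cantor set in $\overline{\mathcal R(x)}$; the orbit $\mathcal O(x)$ is dense in this Cantor set, and the Cantor set is contained in the closure of the orbit of each point of $\mathcal R(x)$. (4) $\overline{\mathcal O(x)}$ contains a nonempty proper subset which is contained in $S^1\setminus P(G)$, is $G$-invariant, is closed with respect to $S^1\setminus P(G)$, and does not intersect $\mathcal O(x)$.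
   Context: $\mathcal O(x)=\{g(x):g\in G\}$ is the group orbit of $x$. Closures are taken in $S^1$. Let $\{C_\alpha\}$ be the (finite) collection of connected components of $S^1\setminus P(G)$; elements of $G$ permute them. The range of $x$ is $\mathcal R(x)=\bigcup_{C_\alpha\cap\mathcal O(x)\neq\emptyset}C_\alpha$. "$G$ restricted to $C_\alpha$" means the group of homeomorphisms obtained by restricting to $C_\alpha$ those $g\in G$ with $g(C_\alpha)=C_\alpha$; identifying the open arc $C_\alpha$ with $(0,1)$ by an orientation-preserving homeomorphism, these maps extend to orientation-preserving homeomorphisms of $[0,1]$ fixing $0$ and $1$. The conditions on a group $H$ of orientation-preserving homeomorphisms of $[0,1]$ are: (C1) there is at least one element of $H$ whose fixed points in $(0,1)$ do not accumulate at $0$ and do not accumulate at $1$; (C2) $H$ is finitely generated and no point of $(0,1)$ is fixed by all of $H$. A Cantor set is a nonempty, compact, perfect, totally disconnected subset of $S^1$. "$\mathcal O(x)$ accumulates only at points of $P(G)$" means that every accumulation point of $\mathcal O(x)$ in $S^1$ lies in $P(G)$. *)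

theory Defs
  imports "HOL-Analysis.Analysis" "HOL-Algebra.Bij" "HOL-Algebra.Generated_Groups"
begin

abbreviation S1 :: "complex set" where
  "S1 \<equiv> sphere 0 1"

text \<open>Orientation is expressed through lifts to the real line: a circle homeomorphism preserves
  orientation iff it has an increasing lift along \<^term>\<open>cis\<close>.\<close>

definition orientation_preserving_circle_homeo :: "(complex \<Rightarrow> complex) \<Rightarrow> bool" where
  "orientation_preserving_circle_homeo f \<longleftrightarrow>
     (\<exists>f'. homeomorphism S1 S1 f f') \<and>
     (\<exists>F :: real \<Rightarrow> real. continuous_on UNIV F \<and> strict_mono F \<and> (\<forall>t. f (cis t) = cis (F t)))"

text \<open>Groups of circle maps are subgroups of \<^term>\<open>BijGroup S1\<close>, so their elements are extensional
  on \<^term>\<open>S1\<close> and are determined by their values on the circle.\<close>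

definition circle_homeo_group :: "(complex \<Rightarrow> complex) set \<Rightarrow> bool" where
  "circle_homeo_group G \<longleftrightarrow>
     subgroup G (BijGroup S1) \<and> (\<forall>g\<in>G. orientation_preserving_circle_homeo g)"

definition group_orbit :: "(complex \<Rightarrow> complex) set \<Rightarrow> complex \<Rightarrow> complex set" where
  "group_orbit G x = {g x | g. g \<in> G}"

definition finite_orbit_points :: "(complex \<Rightarrow> complex) set \<Rightarrow> complex set" where
  "finite_orbit_points G = {x \<in> S1. finite (group_orbit G x)}"

definition orbit_range :: "(complex \<Rightarrow> complex) set \<Rightarrow> complex \<Rightarrow> complex set" where
  "orbit_range G x =
     \<Union>{C \<in> components (S1 - finite_orbit_points G). C \<inter> group_orbit G x \<noteq> {}}"

definition invariant_set :: "(complex \<Rightarrow> complex) set \<Rightarrow> complex set \<Rightarrow> bool" where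
  "invariant_set G A \<longleftrightarrow> (\<forall>g\<in>G. g ` A = A)"

definition dense_subset :: "complex set \<Rightarrow> complex set \<Rightarrow> bool" where
  "dense_subset A B \<longleftrightarrow> A \<subseteq> B \<and> B \<subseteq> closure A"

definition cantor_set :: "complex set \<Rightarrow> bool" where
  "cantor_set K \<longleftrightarrow>
     K \<subseteq> S1 \<and> K \<noteq> {} \<and> compact K \<and>
     (\<forall>z\<in>K. z islimpt K) \<and>
     (\<forall>T. T \<subseteq> K \<and> connected T \<longrightarrow> (\<exists>z. T \<subseteq> {z}))"

definition arc_chart :: "(real \<Rightarrow> complex) \<Rightarrow> complex set \<Rightarrow> bool" where
  "arc_chart \<phi> C \<longleftrightarrow>
     (\<exists>\<psi>. homeomorphism {0<..<1} C \<phi> \<psi>) \<and>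
     (\<exists>\<theta> :: real \<Rightarrow> real. continuous_on {0<..<1} \<theta> \<and> strict_mono_on {0<..<1} \<theta> \<and>
        (\<forall>t\<in>{0<..<1}. \<phi> t = cis (\<theta> t)))"

text \<open>The group of restrictions to \<open>C\<close> of those elements of \<open>G\<close> that map \<open>C\<close> onto itself, transported
  to \<open>(0,1)\<close> by the chart \<open>\<phi>\<close> and extended to \<open>[0,1]\<close> by fixing the endpoints.\<close>

definition restricted_group ::
    "(complex \<Rightarrow> complex) set \<Rightarrow> complex set \<Rightarrow> (real \<Rightarrow> complex) \<Rightarrow> (real \<Rightarrow> real) set" where
  "restricted_group G C \<phi> =
     {(\<lambda>t\<in>{0..1}. if 0 < t \<and> t < 1 then inv_into {0<..<1} \<phi> (g (\<phi> t)) else t) | g.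
        g \<in> G \<and> g ` C = C}"

definition condition_C1 :: "(real \<Rightarrow> real) set \<Rightarrow> bool" where
  "condition_C1 H \<longleftrightarrow>
     (\<exists>h\<in>H. \<not> 0 islimpt {t \<in> {0<..<1}. h t = t} \<and> \<not> 1 islimpt {t \<in> {0<..<1}. h t = t})"

definition condition_C2 :: "(real \<Rightarrow> real) set \<Rightarrow> bool" where
  "condition_C2 H \<longleftrightarrow>
     (\<exists>A. finite A \<and> A \<subseteq> H \<and> generate (BijGroup {0..1}) A = H) \<and>
     \<not> (\<exists>t\<in>{0<..<1}. \<forall>h\<in>H. h t = t)"

end

theory Submission
  imports Defs
begin

text \<open>Write \<open>X\<close> for the complement of the finite orbits and \<open>L\<close> for the closure of the orbit of \<open>x\<close>
  in \<open>X\<close>. If possibility (4) fails, \<open>L\<close> is minimal among the nonempty invariant subsets that are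
  closed in \<open>X\<close>. Applied to the limit points of the orbit, minimality gives (2) or makes the orbit
  perfect; applied to the frontier of \<open>L\<close> in \<open>X\<close>, it gives (1) or makes \<open>L\<close> nowhere dense. In the
  remaining case the closure of the orbit is a Cantor set, and a point in a gap of \<open>L\<close> is carried
  close to an endpoint of that gap, because the translates of the gap that accumulate at the endpoint
  shrink to it.\<close>

section \<open>Order and connectedness in arcs\<close>

text \<open>Three distinct elements can be sorted. In \<open>gap_orbit_closure_meets\<close> the
  middle one is the parameter of a translated endpoint and the outer two act as barriers.\<close>

lemma infinite_imp_three_increasing:
  fixes S :: "'a::linorder set"
  assumes "infinite S"
  obtains a b c where "a \<in> S" "b \<in> S" "c \<in> S" "a < b" "b < c"
proof -
  obtain F where F: "F \<subseteq> S" "card F = 3" "finite F"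
    using infinite_arbitrarily_large [OF assms] by blast
  then obtain u v w where "F = {u, v, w}" "u \<noteq> v" "u \<noteq> w" "v \<noteq> w"
    by (auto simp: card_3_iff)
  then have "u \<in> S" "v \<in> S" "w \<in> S" "u \<noteq> v" "u \<noteq> w" "v \<noteq> w"
    using F by auto
  then show thesis
    using that by (metis linorder_neqE)
qed

lemma openin_image_chart:
  assumes "homeomorphism {0<..<1::real} C \<phi> \<psi>" "openin (top_of_set S) C"
    and "0 \<le> a" "b \<le> 1"
  shows "openin (top_of_set S) (\<phi> ` {a<..<b})"
proof -
  have "openin (top_of_set {0<..<1}) {a<..<b}"
    using assms(3,4) by (intro open_subset) auto
  then show ?thesis
    using homeomorphism_imp_open_map [OF assms(1)] assms(2) openin_trans by blast
qed

text \<open>The complement of \<open>L\<close> cuts every arc arbitrarily finely. Two cuts around a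
  point of \<open>T\<close> in an arc confine \<open>T\<close> to that arc, and further cuts shrink
  it to a point. This yields the total disconnectedness of the orbit closure.\<close>

lemma connected_subset_of_arcs_trivial:
  fixes S :: "'a::metric_space set"
  assumes "finite P" "L \<subseteq> S - P" "L \<subseteq> closure (S - P - L)"
    and opn: "\<And>C. C \<in> components (S - P) \<Longrightarrow> openin (top_of_set S) C"
    and chart: "\<And>C. C \<in> components (S - P) \<Longrightarrow> \<exists>\<phi> \<psi>. homeomorphism {0<..<1::real} C \<phi> \<psi>"
    and T: "connected T" "T \<subseteq> L \<union> P"
  shows "\<exists>z. T \<subseteq> {z}"
proof (cases "T \<subseteq> P")
  case True
  then have "finite T"
    using assms(1) finite_subset by blast
  then show ?thesis
    using T(1) by (auto simp: connected_finite_iff_sing)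
next
  case False
  then obtain t where t: "t \<in> T" "t \<in> L" "t \<in> S - P"
    using T assms(2) by blast
  then obtain C where C: "C \<in> components (S - P)" "t \<in> C"
    by (metis Union_components UnionE)
  obtain \<phi> \<psi> where hom: "homeomorphism {0<..<1::real} C \<phi> \<psi>"
    using chart [OF C(1)] by blast
  have CX: "C \<subseteq> S - P"
    using C(1) in_components_subset by blast
  \<comment> \<open>If \<open>L\<close> contained the image of an open interval, that image would be
    open in \<open>S\<close> and would meet \<open>S - P - L\<close>, whose closure contains
    \<open>L\<close>.\<close>
  have dense: "\<exists>s. a < s \<and> s < c \<and> \<phi> s \<notin> L" if "0 \<le> a" "a < c" "c \<le> 1" for a c
  proof (rule ccontr)
    assume "\<not> ?thesis"
    then have sub: "\<phi> ` {a<..<c} \<subseteq> L"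
      by auto
    obtain m where m: "a < m" "m < c"
      using Orderings.dense [OF \<open>a < c\<close>] by blast
    have "openin (top_of_set S) (\<phi> ` {a<..<c})"
      by (rule openin_image_chart [OF hom opn [OF C(1)] that(1,3)])
    then obtain W where W: "open W" "\<phi> ` {a<..<c} = S \<inter> W"
      by (auto simp: openin_open)
    have "\<phi> m \<in> \<phi> ` {a<..<c}"
      using m by simp
    then have "\<phi> m \<in> W" "\<phi> m \<in> closure (S - P - L)"
      using W(2) sub assms(3) by blast+
    then obtain z where "z \<in> W" "z \<in> S - P - L"
      using W(1) by (meson closure_iff_nhds_not_empty disjoint_iff subset_refl)
    then show False
      using W(2) sub by blast
  qed
  have s: "\<psi> t \<in> {0<..<1}" "\<phi> (\<psi> t) = t"
    using hom C(2) unfolding homeomorphism_def by blast+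
  \<comment> \<open>Cut points on either side of \<open>t\<close>. Since \<open>T\<close> misses
    both, the open and the closed arc between them have the same trace on \<open>T\<close>, which
    makes this trace clopen in \<open>T\<close>.\<close>
  obtain a where a: "0 < a" "a < \<psi> t" "\<phi> a \<notin> L"
    using dense [of 0 "\<psi> t"] s by auto
  obtain c where c: "\<psi> t < c" "c < 1" "\<phi> c \<notin> L"
    using dense [of "\<psi> t" 1] s by auto
  have sub01: "{a..c} \<subseteq> {0<..<1}"
    using a c by auto
  have im: "\<phi> ` {0<..<1} = C"
    using hom unfolding homeomorphism_def by blast
  then have "\<phi> a \<in> C" "\<phi> c \<in> C"
    using a c s by auto
  then have "\<phi> a \<notin> T" "\<phi> c \<notin> T"
    using a c T(2) CX by blast+
  moreover have "{a..c} = {a<..<c} \<union> {a, c}"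
    using a c by auto
  ultimately have eq: "T \<inter> \<phi> ` {a<..<c} = T \<inter> \<phi> ` {a..c}"
    by auto
  have TS: "T \<subseteq> S \<union> P"
    using T(2) assms(2) by blast
  have "openin (top_of_set S) (\<phi> ` {a<..<c})"
    using openin_image_chart [OF hom opn [OF C(1)]] a c by auto
  then obtain W where W: "open W" "\<phi> ` {a<..<c} = S \<inter> W"
    by (auto simp: openin_open)
  \<comment> \<open>\<open>T\<close> may contain points of \<open>P\<close> outside
    \<open>S\<close>. They are removed from \<open>W\<close>, which stays open because
    \<open>P\<close> is finite.\<close>
  have "T \<inter> \<phi> ` {a<..<c} = T \<inter> (W - (P - S))"
    using W(2) TS by auto
  moreover have "open (W - (P - S))"
    using W(1) assms(1) by (simp add: finite_imp_closed open_Diff)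
  ultimately have op: "openin (top_of_set T) (T \<inter> \<phi> ` {a<..<c})"
    by (auto simp: openin_open)
  have "continuous_on {a..c} \<phi>"
    using continuous_on_subset [OF homeomorphism_cont1 [OF hom] sub01] .
  then have "closed (\<phi> ` {a..c})"
    by (simp add: compact_continuous_image compact_imp_closed)
  then have cl: "closedin (top_of_set T) (T \<inter> \<phi> ` {a<..<c})"
    unfolding eq by (auto simp: closedin_closed)
  have "t \<in> T \<inter> \<phi> ` {a<..<c}"
    using t a c s by (metis IntI greaterThanLessThan_iff imageI)
  then have "T \<inter> \<phi> ` {a<..<c} = T"
    using T(1) op cl unfolding connected_clopen by blast
  moreover have "\<phi> ` {a<..<c} \<subseteq> C"
    unfolding im [symmetric] using a c s by (intro image_mono) auto
  ultimately have TC: "T \<subseteq> C"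
    by blast
  then have TL: "T \<subseteq> L"
    using CX T(2) by blast
  have "continuous_on T \<psi>"
    using continuous_on_subset [OF homeomorphism_cont2 [OF hom] TC] .
  then have con: "connected (\<psi> ` T)"
    using T(1) by (rule connected_continuous_image)
  \<comment> \<open>The image of \<open>T\<close> under \<psi> contains the whole interval between
    two of its parameters, but \<open>dense\<close> gives a parameter there whose point is outside
    \<open>L\<close>.\<close>
  have le: False if uv: "u \<in> T" "v \<in> T" "\<psi> u < \<psi> v" for u v
  proof -
    have "\<psi> u \<in> {0<..<1}" "\<psi> v \<in> {0<..<1}"
      using homeomorphism_image2 [OF hom] TC uv by blast+
    then have "0 \<le> \<psi> u" "\<psi> v \<le> 1"
      by simp_all
    then obtain r where r: "\<psi> u < r" "r < \<psi> v" "\<phi> r \<notin> L"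
      using dense uv(3) by blast
    then have "r \<in> \<psi> ` T"
      using connected_contains_Icc [OF con imageI [OF uv(1)] imageI [OF uv(2)]] by auto
    then obtain z where z: "z \<in> T" "r = \<psi> z"
      by blast
    have "z \<in> C"
      using z(1) TC by (rule rev_subsetD)
    then have "\<phi> r = z"
      unfolding z(2) by (rule homeomorphism_apply2 [OF hom])
    then show False
      using r(3) z(1) TL by blast
  qed
  have "u = t" if "u \<in> T" for u
  proof -
    have "\<psi> u = \<psi> t"
      using le [OF that t(1)] le [OF t(1) that] by (meson linorder_neqE)
    then show ?thesis
      using homeomorphism_apply2 [OF hom] TC that t(1) by (metis subsetD)
  qed
  then show ?thesis
    by blast
qed

section \<open>Groups of circle homeomorphisms\<close>

lemma closure_subset_S1: "A \<subseteq> S1 \<Longrightarrow> closure A \<subseteq> S1"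
  by (simp add: closure_minimal)

context
  fixes G :: "(complex \<Rightarrow> complex) set"
  assumes G: "circle_homeo_group G"
begin

lemma group_one: "(\<lambda>z\<in>S1. z) \<in> G"
  using G subgroup.one_closed [of G "BijGroup S1"]
  by (simp add: circle_homeo_group_def BijGroup_def)

lemma group_elem_bij: "g \<in> G \<Longrightarrow> bij_betw g S1 S1"
  using G subgroup.subset [of G "BijGroup S1"]
  by (auto simp: circle_homeo_group_def BijGroup_def Bij_def)

lemma group_elem_in: "g \<in> G \<Longrightarrow> z \<in> S1 \<Longrightarrow> g z \<in> S1"
  using group_elem_bij bij_betwE by blast

lemma group_elem_inj: "g \<in> G \<Longrightarrow> inj_on g S1"
  using group_elem_bij bij_betw_def by blast

lemma group_elem_continuous: "g \<in> G \<Longrightarrow> continuous_on S1 g"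
  using G by (auto simp: circle_homeo_group_def orientation_preserving_circle_homeo_def homeomorphism_def)

lemma group_compose:
  assumes "g \<in> G" "h \<in> G"
  obtains k where "k \<in> G" "\<And>z. z \<in> S1 \<Longrightarrow> k z = g (h z)"
proof -
  have sg: "subgroup G (BijGroup S1)"
    using G by (simp add: circle_homeo_group_def)
  have "g \<in> Bij S1" "h \<in> Bij S1"
    using subgroup.subset [OF sg] assms by (auto simp: BijGroup_def)
  then have "compose S1 g h \<in> G"
    using subgroup.m_closed [OF sg assms] by (simp add: BijGroup_def)
  then show thesis
    by (rule that) (simp add: compose_def)
qed

lemma group_inverse:
  assumes "g \<in> G"
  obtains h where "h \<in> G" "\<And>z. z \<in> S1 \<Longrightarrow> h (g z) = z" "\<And>z. z \<in> S1 \<Longrightarrow> g (h z) = z"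
proof -
  have sg: "subgroup G (BijGroup S1)"
    using G by (simp add: circle_homeo_group_def)
  interpret B: group "BijGroup S1"
    by (rule group_BijGroup)
  let ?h = "inv\<^bsub>BijGroup S1\<^esub> g"
  have h: "?h \<in> G"
    using subgroup.m_inv_closed [OF sg assms] .
  have gc: "g \<in> carrier (BijGroup S1)" "?h \<in> carrier (BijGroup S1)"
    using subgroup.subset [OF sg] assms h by blast+
  then have B: "g \<in> Bij S1" "?h \<in> Bij S1"
    by (auto simp: BijGroup_def)
  have "compose S1 ?h g = (\<lambda>z\<in>S1. z)" "compose S1 g ?h = (\<lambda>z\<in>S1. z)"
    using B.l_inv [OF gc(1)] B.r_inv [OF gc(1)] B by (simp_all add: BijGroup_def)
  then have "?h (g z) = z" "g (?h z) = z" if "z \<in> S1" for z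
    using that by (metis compose_eq restrict_apply')+
  then show thesis
    using that h by blast
qed

section \<open>Invariant sets, closures and limit points\<close>

text \<open>Forward invariance suffices: the inverse of \<open>g\<close> also lies in
  \<open>G\<close>, so every point of \<open>A\<close> has its preimage under \<open>g\<close> in
  \<open>A\<close>.\<close>

lemma invariant_setI:
  assumes "A \<subseteq> S1" "\<And>g z. g \<in> G \<Longrightarrow> z \<in> A \<Longrightarrow> g z \<in> A"
  shows "invariant_set G A"
  unfolding invariant_set_def
proof (intro ballI equalityI subsetI)
  fix g z assume "g \<in> G" "z \<in> A"
  moreover then obtain h where "h \<in> G" "\<And>z. z \<in> S1 \<Longrightarrow> g (h z) = z"
    using group_inverse by metis
  ultimately show "z \<in> g ` A"
    using assms by (metis imageI subsetD)
qed (use assms in auto)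

lemma invariant_setD: "invariant_set G A \<Longrightarrow> g \<in> G \<Longrightarrow> z \<in> A \<Longrightarrow> g z \<in> A"
  unfolding invariant_set_def by blast

lemma invariant_set_Int:
  assumes "invariant_set G A" "invariant_set G B" "A \<subseteq> S1"
  shows "invariant_set G (A \<inter> B)"
  using assms(3) invariant_setD [OF assms(1)] invariant_setD [OF assms(2)]
  by (intro invariant_setI) blast+

lemma invariant_set_Diff:
  assumes "invariant_set G A" "invariant_set G B" "A \<subseteq> S1" "B \<subseteq> S1"
  shows "invariant_set G (A - B)"
proof (rule invariant_setI)
  fix g z assume g: "g \<in> G" and z: "z \<in> A - B"
  have "g z \<notin> g ` B"
    using z assms(3,4) inj_on_image_mem_iff [OF group_elem_inj [OF g]] by blast
  then show "g z \<in> A - B"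
    using assms(1,2) g z unfolding invariant_set_def by blast
qed (use assms(3) in auto)

lemma invariant_set_S1: "invariant_set G S1"
  using group_elem_in by (intro invariant_setI) blast+

lemma group_elem_closure:
  assumes "g \<in> G" "A \<subseteq> S1" "z \<in> closure A"
  shows "g z \<in> closure (g ` A)"
proof -
  have "continuous_on (closure A) g"
    using continuous_on_subset [OF group_elem_continuous closure_subset_S1] assms by blast
  then have "g ` closure A \<subseteq> closure (g ` A)"
    by (rule image_closure_subset) (auto intro: closure_subset [THEN subsetD])
  then show ?thesis
    using assms(3) by blast
qed

lemma invariant_set_closure:
  assumes "invariant_set G A" "A \<subseteq> S1"
  shows "invariant_set G (closure A)"
proof (rule invariant_setI [OF closure_subset_S1 [OF assms(2)]])
  fix g z assume "g \<in> G" "z \<in> closure A"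
  then show "g z \<in> closure A"
    using group_elem_closure [of g A z] assms by (simp add: invariant_set_def)
qed

text \<open>An injective \<open>g\<close> maps \<open>A - {z}\<close> onto \<open>A - {g z}\<close>,
  so continuity carries the closure of the first set into that of the second.\<close>

lemma invariant_set_limit_points:
  assumes "invariant_set G A" "A \<subseteq> S1"
  shows "invariant_set G {z. z islimpt A}"
proof (rule invariant_setI)
  show "{z. z islimpt A} \<subseteq> S1"
    using closure_subset_S1 [OF assms(2)] by (auto simp: closure_def)
  then have lim: "z \<in> S1" if "z islimpt A" for z
    using that by blast
  fix g z assume g: "g \<in> G" and z: "z \<in> {z. z islimpt A}"
  then have "z \<in> closure (A - {z})"
    by (simp add: islimpt_in_closure)
  then have "g z \<in> closure (g ` (A - {z}))"
    using group_elem_closure g assms(2) by blast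
  moreover have "g ` (A - {z}) = A - {g z}"
    using inj_on_image_set_diff [OF group_elem_inj [OF g], of A "{z}"] assms g z lim
    unfolding invariant_set_def
    by (metis (no_types, lifting) Diff_subset empty_subsetI image_empty image_insert insert_subset
        mem_Collect_eq order_trans)
  ultimately show "g z \<in> {z. z islimpt A}"
    by (simp add: islimpt_in_closure)
qed

section \<open>Orbits\<close>

lemma orbit_subset_S1: "x \<in> S1 \<Longrightarrow> group_orbit G x \<subseteq> S1"
  by (auto simp: group_orbit_def dest: group_elem_in)

lemma orbit_self: "x \<in> S1 \<Longrightarrow> x \<in> group_orbit G x"
  unfolding group_orbit_def using group_one by (metis (mono_tags, lifting) mem_Collect_eq restrict_apply')

lemma orbit_invariant:
  assumes "x \<in> S1"
  shows "invariant_set G (group_orbit G x)"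
proof (rule invariant_setI [OF orbit_subset_S1 [OF assms]])
  fix g z assume g: "g \<in> G" and "z \<in> group_orbit G x"
  then obtain h where h: "h \<in> G" "z = h x"
    by (auto simp: group_orbit_def)
  obtain k where "k \<in> G" "k x = g (h x)"
    using group_compose [OF g h(1)] assms by metis
  then show "g z \<in> group_orbit G x"
    using h by (metis (mono_tags, lifting) group_orbit_def mem_Collect_eq)
qed

lemma orbit_subset: "invariant_set G A \<Longrightarrow> y \<in> A \<Longrightarrow> group_orbit G y \<subseteq> A"
  by (auto simp: group_orbit_def dest: invariant_setD)

text \<open>If \<open>g x\<close> lies in \<open>A\<close>, applying the inverse of \<open>g\<close>
  puts \<open>x\<close> itself in \<open>A\<close>.\<close>

lemma orbit_subset_of_meets:
  assumes "invariant_set G A" "x \<in> S1" "A \<inter> group_orbit G x \<noteq> {}"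
  shows "group_orbit G x \<subseteq> A"
proof -
  obtain g where g: "g \<in> G" "g x \<in> A"
    using assms(3) by (auto simp: group_orbit_def)
  obtain h where "h \<in> G" "h (g x) = x"
    using group_inverse [OF g(1)] assms(2) by metis
  then have "x \<in> A"
    using invariant_setD [OF assms(1)] g(2) by metis
  then show ?thesis
    using orbit_subset assms(1) by blast
qed

text \<open>The orbit of \<open>g z\<close> is contained in the orbit of \<open>z\<close>, so it
  stays finite.\<close>

lemma invariant_finite_orbit_points: "invariant_set G (finite_orbit_points G)"
proof (rule invariant_setI)
  fix g z assume g: "g \<in> G" and z: "z \<in> finite_orbit_points G"
  then have "z \<in> S1"
    by (simp add: finite_orbit_points_def)
  then have "g z \<in> group_orbit G z"
    using g by (auto simp: group_orbit_def)
  then have "group_orbit G (g z) \<subseteq> group_orbit G z"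
    using orbit_subset orbit_invariant \<open>z \<in> S1\<close> by blast
  then show "g z \<in> finite_orbit_points G"
    using g z group_elem_in unfolding finite_orbit_points_def by (auto intro: finite_subset)
qed (auto simp: finite_orbit_points_def)

section \<open>Orbits of points in the gaps of an invariant set\<close>

text \<open>A component \<open>U\<close> of \<open>C - L\<close> has an endpoint \<open>b \<in> L\<close>. Translates of \<open>U\<close> avoid \<open>L\<close>, so if
  \<open>g b\<close> lies between two further points of the orbit of \<open>b\<close> near \<open>b\<close>, then \<open>g U\<close> is trapped
  between them as well.\<close>

lemma gap_orbit_closure_meets:
  assumes X: "openin (top_of_set S1) X" "invariant_set G X"
    and L: "closedin (top_of_set X) L" "invariant_set G L"
    and lim: "\<And>b. b \<in> L \<Longrightarrow> b islimpt group_orbit G b"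
    and C: "C \<in> components X" "C \<inter> L \<noteq> {}" and hom: "homeomorphism {0<..<1::real} C \<phi> \<psi>"
    and y: "y \<in> C" "y \<notin> L"
  shows "closure (group_orbit G y) \<inter> L \<noteq> {}"
proof -
  have XS: "X \<subseteq> S1" and LX: "L \<subseteq> X" and CX: "C \<subseteq> X"
    using openin_imp_subset [OF X(1)] closedin_imp_subset [OF L(1)] in_components_subset [OF C(1)] .
  have locS: "locally connected X"
    using locally_open_subset [OF locally_connected_sphere X(1)] .
  have opC: "openin (top_of_set S1) C"
    using openin_components_locally_connected [OF locS C(1)] X(1) openin_trans by blast
  have opXL: "openin (top_of_set X) (X - L)"
    using L(1) by (simp add: openin_diff)
  have loc: "locally connected (X - L)"
    using locally_open_subset [OF locS opXL] .
  define U where "U = connected_component_set (X - L) y"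
  have yXL: "y \<in> X - L"
    using y CX by blast
  then have Uc: "U \<in> components (X - L)" and yU: "y \<in> U" and conU: "connected U"
    by (auto simp: U_def componentsI)
  have UXL: "U \<subseteq> X - L"
    using Uc in_components_subset by blast
  have UC: "U \<subseteq> C"
    using components_maximal [OF C(1) conU] UXL yU y(1) by blast
  have "openin (top_of_set X) U"
    using openin_components_locally_connected [OF loc Uc] opXL openin_trans by blast
  then have "openin (top_of_set C) U"
    using UC CX openin_subset_trans by blast
  moreover have "U \<noteq> {}" "U \<noteq> C"
    using yU C(2) UXL by blast+
  \<comment> \<open>\<open>U\<close> is open in the connected set \<open>C\<close>, nonempty and
    proper, so it fails to be closed there. This yields the endpoint \<open>b\<close>.\<close>
  ultimately have "\<not> closedin (top_of_set C) U"
    using in_components_connected [OF C(1)] unfolding connected_clopen by blast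
  then have "C \<inter> closure U \<noteq> U"
    by (metis closed_closure closedin_closed_Int)
  then obtain b where b: "b \<in> C" "b \<in> closure U" "b \<notin> U"
    using UC closure_subset by blast
  \<comment> \<open>Otherwise adjoining \<open>b\<close> to \<open>U\<close> would give a larger
    connected subset of \<open>X - L\<close>, against the maximality of a component.\<close>
  have bL: "b \<in> L"
  proof (rule ccontr)
    assume "b \<notin> L"
    have "connected (insert b U)"
      by (rule connected_intermediate_closure [OF conU]) (use b closure_subset in auto)
    then have "insert b U \<subseteq> U"
      using components_maximal [OF Uc, of "insert b U"] UXL yU b(1) CX \<open>b \<notin> L\<close> by blast
    then show False
      using b by blast
  qed
  have bS: "b \<in> S1"
    using bL LX XS by blast
  have "b \<in> closure (group_orbit G y)"
    unfolding closure_iff_nhds_not_empty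
  proof (intro allI impI)
    fix A V assume V: "V \<subseteq> A" "open V" "b \<in> V"
    have p: "\<psi> b \<in> {0<..<1}" "\<phi> (\<psi> b) = b"
      using hom b(1) unfolding homeomorphism_def by blast+
    have "openin (top_of_set {0<..<1}) ({0<..<1} \<inter> \<phi> -` V)"
      using continuous_openin_preimage_gen [OF homeomorphism_cont1 [OF hom] V(2)] .
    then have "open ({0<..<1} \<inter> \<phi> -` V)"
      using openin_open_trans open_greaterThanLessThan by blast
    moreover have "\<psi> b \<in> {0<..<1} \<inter> \<phi> -` V"
      using p V by auto
    ultimately obtain e where e: "e > 0" "ball (\<psi> b) e \<subseteq> {0<..<1} \<inter> \<phi> -` V"
      by (meson openE)
    \<comment> \<open>A parameter interval around that of \<open>b\<close>, mapped into
      \<open>V\<close> by the chart; it suffices to find a translate of \<open>y\<close> with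
      parameter in \<open>I\<close>.\<close>
    define I where "I = {\<psi> b - e<..<\<psi> b + e}"
    have I: "I \<subseteq> {0<..<1}" "\<phi> ` I \<subseteq> V" "\<psi> b \<in> I"
      using e by (auto simp: I_def ball_eq_greaterThanLessThan)
    have "openin (top_of_set {0<..<1}) I"
      using I(1) by (intro open_subset) (auto simp: I_def)
    then have "openin (top_of_set S1) (\<phi> ` I)"
      using homeomorphism_imp_open_map [OF hom] opC openin_trans by blast
    then obtain W where W: "open W" "\<phi> ` I = S1 \<inter> W"
      by (auto simp: openin_open)
    have "b \<in> W"
      using W(2) I(3) p(2) by (metis IntE imageI)
    \<comment> \<open>By \<open>lim\<close>, infinitely many points of the orbit of \<open>b\<close>
      lie in \<open>W\<close>, and all of these have parameters in \<open>I\<close>.\<close>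
    then have "infinite (W \<inter> group_orbit G b)"
      using lim [OF bL] W(1) by (simp add: islimpt_eq_acc_point)
    moreover have sub: "W \<inter> group_orbit G b \<subseteq> \<phi> ` I"
      using W(2) orbit_subset_S1 [OF bS] by blast
    have IC: "\<phi> ` I \<subseteq> C"
      using hom I(1) unfolding homeomorphism_def by blast
    have "inj_on \<psi> C"
      using hom unfolding homeomorphism_def by (metis inj_onI)
    then have "inj_on \<psi> (W \<inter> group_orbit G b)"
      using sub IC inj_on_subset by blast
    ultimately have "infinite (\<psi> ` (W \<inter> group_orbit G b))"
      by (simp add: finite_image_iff)
    then obtain t1 t2 t3 where t: "t1 \<in> \<psi> ` (W \<inter> group_orbit G b)" "t2 \<in> \<psi> ` (W \<inter> group_orbit G b)"
        "t3 \<in> \<psi> ` (W \<inter> group_orbit G b)" "t1 < t2" "t2 < t3"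
      by (rule infinite_imp_three_increasing)
    have tI: "t \<in> I \<and> \<phi> t \<in> L" if t: "t \<in> \<psi> ` (W \<inter> group_orbit G b)" for t
    proof -
      obtain z where z: "z \<in> W \<inter> group_orbit G b" "t = \<psi> z"
        using t by blast
      then obtain s where s: "s \<in> I" "z = \<phi> s"
        using sub by blast
      then have "t = s"
        using homeomorphism_apply1 [OF hom] I(1) z by auto
      then show ?thesis
        using s z orbit_subset [OF L(2) bL] by auto
    qed
    obtain g where g: "g \<in> G" "t2 = \<psi> (g b)" "g b \<in> C"
      using t(2) sub IC by (auto simp: group_orbit_def)
    \<comment> \<open>The translated gap with its endpoint \<open>g b\<close> is connected and meets
      \<open>L\<close> only at \<open>g b\<close>. Hence \<psi> cannot send any of its points to
      \<open>t1\<close> or \<open>t3\<close>, which are parameters of other points of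
      \<open>L\<close>.\<close>
    define Y where "Y = insert (g b) (g ` U)"
    have US: "U \<subseteq> S1"
      using UXL XS by blast
    have "connected (g ` U)"
      using connected_continuous_image [OF continuous_on_subset [OF group_elem_continuous [OF g(1)] US] conU] .
    moreover have "Y \<subseteq> closure (g ` U)"
      using group_elem_closure [OF g(1) US b(2)] closure_subset [of "g ` U"] by (simp add: Y_def)
    moreover have "g ` U \<subseteq> Y"
      by (auto simp: Y_def)
    ultimately have conY: "connected Y"
      using connected_intermediate_closure by metis
    have gU: "g ` U \<subseteq> X - L"
      using invariant_set_Diff [OF X(2) L(2) XS] LX XS UXL g(1) by (auto dest: invariant_setD)
    have "Y \<subseteq> X"
      using gU g(3) CX by (auto simp: Y_def)
    \<comment> \<open>The point \<open>g b\<close> of \<open>C\<close> anchors the connected set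
      \<open>Y\<close> in that component, where \<psi> is continuous.\<close>
    then have YC: "Y \<subseteq> C"
      using components_maximal [OF C(1) conY] g(3) by (auto simp: Y_def)
    have "continuous_on Y \<psi>"
      using continuous_on_subset [OF homeomorphism_cont2 [OF hom] YC] .
    then have con: "connected (\<psi> ` Y)"
      using conY by (rule connected_continuous_image)
    have out: "t \<notin> \<psi> ` Y" if t: "t \<in> \<psi> ` (W \<inter> group_orbit G b)" "t \<noteq> t2" for t
    proof
      assume "t \<in> \<psi> ` Y"
      then obtain z where z: "z \<in> Y" "t = \<psi> z"
        by blast
      then have "\<phi> t = z"
        using homeomorphism_apply2 [OF hom] YC by blast
      then have "z \<in> L"
        using tI [OF t(1)] by blast
      then have "z = g b"
        using z gU by (auto simp: Y_def)
      then show False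
        using z t(2) g(2) by simp
    qed
    have mem: "t2 \<in> \<psi> ` Y" "\<psi> (g y) \<in> \<psi> ` Y"
      using g yU by (auto simp: Y_def)
    \<comment> \<open>The parameter of \<open>g y\<close> cannot lie at or beyond \<open>t1\<close>
      or \<open>t3\<close>, because the interval joining it to \<open>t2\<close> lies in the image
      of \<open>Y\<close> and would contain that value.\<close>
    have "t1 \<notin> {\<psi> (g y)..t2}" "t3 \<notin> {t2..\<psi> (g y)}"
      using connected_contains_Icc [OF con mem(2,1)] connected_contains_Icc [OF con mem(1,2)]
        out [OF t(1)] out [OF t(3)] t(4,5) by blast+
    then have "\<not> \<psi> (g y) \<le> t1" "\<not> t3 \<le> \<psi> (g y)"
      using t(4,5) by auto
    then have "\<psi> (g y) \<in> I"
      using tI [OF t(1)] tI [OF t(3)] by (auto simp: I_def)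
    moreover have "g y \<in> C"
      using YC yU by (auto simp: Y_def)
    ultimately have "g y \<in> V"
      using I(2) homeomorphism_apply2 [OF hom] by (metis image_subset_iff)
    then show "group_orbit G y \<inter> A \<noteq> {}"
      using V(1) g(1) by (auto simp: group_orbit_def)
  qed
  then show ?thesis
    using bL by blast
qed

end

section \<open>Minimality and the four possibilities\<close>

theorem theorem1:
  fixes G :: "(complex \<Rightarrow> complex) set" and x :: complex
  assumes "circle_homeo_group G"
    and "finite (finite_orbit_points G)" and "finite_orbit_points G \<noteq> {}"
    and "\<And>C. C \<in> components (S1 - finite_orbit_points G) \<Longrightarrow>
           \<exists>\<phi>. arc_chart \<phi> C \<and>
             (condition_C1 (restricted_group G C \<phi>) \<or> condition_C2 (restricted_group G C \<phi>))"
    and "x \<in> S1 - finite_orbit_points G"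
  shows
    "dense_subset (group_orbit G x) (orbit_range G x)
     \<or> (\<forall>y\<in>S1. y islimpt group_orbit G x \<longrightarrow> y \<in> finite_orbit_points G)
     \<or> (\<exists>K. cantor_set K \<and> invariant_set G K \<and> K \<subseteq> closure (orbit_range G x) \<and>
            group_orbit G x \<subseteq> K \<and> dense_subset (group_orbit G x) K \<and>
            (\<forall>y\<in>orbit_range G x. K \<subseteq> closure (group_orbit G y)))
     \<or> (\<exists>A. A \<noteq> {} \<and> A \<subset> closure (group_orbit G x) \<and>
            A \<subseteq> S1 - finite_orbit_points G \<and> invariant_set G A \<and>
            closedin (top_of_set (S1 - finite_orbit_points G)) A \<and>
            A \<inter> group_orbit G x = {})" (is "?dense \<or> ?discrete \<or> ?cantor \<or> ?subset")
proof -
  note G = assms(1)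
  define P where "P = finite_orbit_points G"
  define X where "X = S1 - P"
  define Ob where "Ob = group_orbit G x"
  \<comment> \<open>\<open>P\<close> is left out because possibility (4) concerns sets closed
    relative to its complement.\<close>
  define L where "L = X \<inter> closure Ob"
  have P: "finite P" "invariant_set G P" "P \<subseteq> S1"
    using assms(2) invariant_finite_orbit_points [OF G] by (auto simp: P_def finite_orbit_points_def)
  have x: "x \<in> X" "x \<in> S1" and XS: "X \<subseteq> S1"
    using assms(5) by (auto simp: X_def P_def)
  have opX: "openin (top_of_set S1) X"
    unfolding X_def using P by (simp add: openin_diff finite_imp_closedin)
  have invX: "invariant_set G X"
    unfolding X_def using invariant_set_Diff [OF G invariant_set_S1 [OF G] P(2)] P(3) by simp
  have Ob: "Ob \<subseteq> S1" "x \<in> Ob" "invariant_set G Ob" "Ob \<subseteq> X"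
    unfolding Ob_def using orbit_subset_S1 orbit_self orbit_invariant orbit_subset G x invX by blast+
  have invL: "invariant_set G L"
    unfolding L_def by (intro invariant_set_Int [OF G] invariant_set_closure [OF G] invX Ob XS)
  have clL: "closedin (top_of_set X) L"
    unfolding L_def by (simp add: closedin_closed_Int)
  have OL: "Ob \<subseteq> L" and LX: "L \<subseteq> X"
    using Ob closure_subset by (auto simp: L_def)
  have opC: "openin (top_of_set S1) C" if "C \<in> components X" for C
    using openin_components_locally_connected [OF _ that] opX openin_trans
      locally_open_subset [OF locally_connected_sphere opX] by blast
  have chart: "\<exists>\<phi> \<psi>. homeomorphism {0<..<1::real} C \<phi> \<psi>" if "C \<in> components X" for C
    using assms(4) that unfolding arc_chart_def X_def P_def by blast
  have range: "orbit_range G x = \<Union>{C \<in> components X. C \<inter> Ob \<noteq> {}}"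
    by (simp add: orbit_range_def X_def P_def Ob_def)
  have OR: "Ob \<subseteq> orbit_range G x"
    unfolding range using Ob(4) Union_components [of X] by blast
  have RX: "orbit_range G x \<subseteq> X"
    unfolding range using in_components_subset by blast
  show ?thesis
  proof (rule ccontr)
    assume neg: "\<not> ?thesis"
    \<comment> \<open>Failure of (4) forces \<open>A\<close> to meet the orbit. Invariance then puts
      the whole orbit in \<open>A\<close>, and relative closedness adds the rest of
      \<open>L\<close>.\<close>
    have minimal: "A = L"
      if A: "A \<noteq> {}" "A \<subseteq> L" "invariant_set G A" "closedin (top_of_set X) A" for A
    proof -
      have "A \<inter> Ob \<noteq> {}"
      proof
        assume "A \<inter> Ob = {}"
        moreover from this have "A \<subset> closure Ob"
          using A(2) Ob(2) closure_subset by (auto simp: L_def)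
        moreover have "A \<subseteq> X"
          using A(2) LX by blast
        ultimately have ?subset
          using A unfolding Ob_def X_def P_def by blast
        then show False
          using neg by blast
      qed
      then have "Ob \<subseteq> A"
        using orbit_subset_of_meets [OF G A(3) x(2)] by (simp add: Ob_def)
      moreover obtain T where "closed T" "A = X \<inter> T"
        using A(4) by (auto simp: closedin_closed)
      ultimately have "L \<subseteq> A"
        unfolding L_def by (metis Int_mono closure_minimal inf.boundedE subset_refl)
      then show ?thesis
        using A(2) by blast
    qed
    \<comment> \<open>Failure of (2) makes this set nonempty, so by minimality every point of
      \<open>L\<close> is a limit point of the orbit.\<close>
    have "X \<inter> {z. z islimpt Ob} = L"
    proof (rule minimal)
      show "X \<inter> {z. z islimpt Ob} \<noteq> {}"
        using neg by (auto simp: X_def P_def Ob_def)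
      show "X \<inter> {z. z islimpt Ob} \<subseteq> L"
        by (auto simp: L_def closure_def)
      show "invariant_set G (X \<inter> {z. z islimpt Ob})"
        by (intro invariant_set_Int [OF G] invariant_set_limit_points [OF G] invX Ob XS)
      show "closedin (top_of_set X) (X \<inter> {z. z islimpt Ob})"
        by (simp add: closedin_closed_Int closed_limpts)
    qed
    then have limO: "z islimpt Ob" if "z \<in> L" for z
      using that by blast
    \<comment> \<open>Minimality applied to the relative closure of the orbit of \<open>y\<close>:
      every orbit in \<open>L\<close> is dense in \<open>L\<close>.\<close>
    have dense: "L \<subseteq> closure (group_orbit G y)" if "y \<in> L" for y
    proof -
      have yS: "y \<in> S1"
        using that LX XS by blast
      have sub: "group_orbit G y \<subseteq> L"
        using orbit_subset [OF G invL that] .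
      have "X \<inter> closure (group_orbit G y) = L"
      proof (rule minimal)
        show "X \<inter> closure (group_orbit G y) \<noteq> {}"
          using that LX orbit_self [OF G yS] closure_subset by blast
        have "closure (group_orbit G y) \<subseteq> closure Ob"
          using sub by (intro closure_minimal) (auto simp: L_def)
        then show "X \<inter> closure (group_orbit G y) \<subseteq> L"
          by (auto simp: L_def)
        show "invariant_set G (X \<inter> closure (group_orbit G y))"
          by (intro invariant_set_Int [OF G] invariant_set_closure [OF G] invX orbit_invariant [OF G]
              orbit_subset_S1 [OF G] yS XS)
      qed (simp add: closedin_closed_Int)
      then show ?thesis
        by blast
    qed
    have XL: "invariant_set G (X - L)" "X - L \<subseteq> S1"
      using invariant_set_Diff [OF G invX invL] XS LX by auto
    \<comment> \<open>If the frontier of \<open>L\<close> in \<open>X\<close> is empty,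
      \<open>L\<close> is clopen in \<open>X\<close> and fills every component it meets, which gives
      (1). A nonempty frontier is invariant and relatively closed, so it is all of
      \<open>L\<close>.\<close>
    have frontier: "L \<subseteq> closure (X - L)"
    proof (cases "L \<inter> closure (X - L) = {}")
      case True
      have "C \<subseteq> L" if C: "C \<in> components X" "C \<inter> Ob \<noteq> {}" for C
      proof -
        have CX: "C \<subseteq> X"
          using C(1) in_components_subset by blast
        have "closedin (top_of_set C) (C \<inter> L)"
          using CX unfolding L_def by (metis Int_absorb2 closed_closure closedin_closed_Int inf_assoc)
        moreover have "C \<inter> L = C \<inter> - closure (X - L)"
          using True CX closure_subset [of "X - L"] by blast
        then have "openin (top_of_set C) (C \<inter> L)"
          by (metis closed_closure open_Compl openin_open_Int)
        moreover have "C \<inter> L \<noteq> {}"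
          using C(2) OL by blast
        ultimately show ?thesis
          using in_components_connected [OF C(1)] unfolding connected_clopen by blast
      qed
      then have "orbit_range G x \<subseteq> closure Ob"
        unfolding range L_def by blast
      then have ?dense
        using OR by (simp add: dense_subset_def Ob_def)
      then show ?thesis
        using neg by blast
    next
      case False
      have "L \<inter> closure (X - L) = L"
      proof (rule minimal [OF False])
        show "invariant_set G (L \<inter> closure (X - L))"
          using LX XS by (intro invariant_set_Int [OF G] invariant_set_closure [OF G] invL XL) auto
        show "closedin (top_of_set X) (L \<inter> closure (X - L))"
          unfolding L_def Int_assoc by (intro closedin_closed_Int closed_Int closed_closure)
      qed auto
      then show ?thesis
        by blast
    qed
    \<comment> \<open>\<open>b\<close> is a limit point of \<open>Ob\<close>, which lies in the
      closure of the orbit of \<open>b\<close>; passing to the closure creates no new limit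
      points.\<close>
    have lim: "b islimpt group_orbit G b" if "b \<in> L" for b
    proof -
      have "b islimpt closure (group_orbit G b)"
        using limO [OF that] OL dense [OF that] islimpt_subset by blast
      then show ?thesis
        by (simp add: limpt_of_closure)
    qed
    \<comment> \<open>Closing up the orbit in the circle adds only points of the finite set
      \<open>P\<close> to \<open>L\<close>, as \<open>connected_subset_of_arcs_trivial\<close>
      allows.\<close>
    have KLP: "closure Ob \<subseteq> L \<union> P"
      using closure_subset_S1 [OF Ob(1)] by (auto simp: L_def X_def)
    have "cantor_set (closure Ob)"
      unfolding cantor_set_def
    proof (intro conjI ballI allI impI)
      show "closure Ob \<subseteq> S1"
        using closure_subset_S1 [OF Ob(1)] .
      then show "compact (closure Ob)"
        by (meson bounded_sphere bounded_subset closed_closure compact_eq_bounded_closed)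
      show "closure Ob \<noteq> {}"
        using Ob(2) by auto
      \<comment> \<open>Points of the closure outside \<open>Ob\<close> are limit points by
        definition; points of \<open>Ob\<close> are limit points by \<open>limO\<close>.\<close>
      show "z islimpt closure Ob" if "z \<in> closure Ob" for z
        using that limO OL unfolding limpt_of_closure by (auto simp: closure_def)
      show "\<exists>z. T \<subseteq> {z}" if "T \<subseteq> closure Ob \<and> connected T" for T
        using connected_subset_of_arcs_trivial [of P L S1 T] P(1) LX frontier opC chart that KLP
        unfolding X_def by blast
    qed
    moreover have "invariant_set G (closure Ob)"
      using invariant_set_closure [OF G Ob(3,1)] .
    moreover have "closure Ob \<subseteq> closure (orbit_range G x)"
      using OR by (rule closure_mono)
    moreover have "dense_subset Ob (closure Ob)"
      by (simp add: dense_subset_def closure_subset)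
    \<comment> \<open>It suffices that the orbit closure of \<open>y\<close> contains some
      \<open>b\<close> in \<open>L\<close>: being closed and invariant, it then contains the closure
      of the orbit of \<open>b\<close>, which covers \<open>L\<close>.\<close>
    moreover have "closure Ob \<subseteq> closure (group_orbit G y)" if y: "y \<in> orbit_range G x" for y
    proof -
      have yS: "y \<in> S1"
        using y RX XS by blast
      have "\<exists>b \<in> L. b \<in> closure (group_orbit G y)"
      proof (cases "y \<in> L")
        case True
        then show ?thesis
          using orbit_self [OF G yS] closure_subset by blast
      next
        case False
        \<comment> \<open>A component in the range meets the orbit and hence \<open>L\<close>, so
          \<open>y\<close> lies in a gap of \<open>L\<close> within an arc that also contains points
          of \<open>L\<close>.\<close>
        obtain C where C: "C \<in> components X" "C \<inter> Ob \<noteq> {}" "y \<in> C"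
          using y unfolding range by blast
        obtain \<phi> \<psi> where hom: "homeomorphism {0<..<1::real} C \<phi> \<psi>"
          using chart [OF C(1)] by blast
        have "C \<inter> L \<noteq> {}"
          using C(2) OL by blast
        then show ?thesis
          using gap_orbit_closure_meets [OF G opX invX clL invL lim C(1) _ hom C(3) False] by blast
      qed
      then obtain b where b: "b \<in> L" "b \<in> closure (group_orbit G y)"
        by blast
      have "group_orbit G b \<subseteq> closure (group_orbit G y)"
        using orbit_subset [OF G _ b(2)] invariant_set_closure [OF G] orbit_invariant [OF G yS]
          orbit_subset_S1 [OF G yS] by blast
      then have "closure (group_orbit G b) \<subseteq> closure (group_orbit G y)"
        by (simp add: closure_minimal)
      then show ?thesis
        using dense [OF b(1)] OL by (intro closure_minimal) auto
    qed
    ultimately have ?cantor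
      using closure_subset unfolding Ob_def by blast
    then show False
      using neg by blast
  qed
qed

end
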